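(* Let $a,b,d\in\mathbb{C}_p$ with $a\neq 0$ and ($b\neq -2a^2$ or $d\neq -2a$), and let $$f(x)=\frac{ax^2+bx+\left(\frac{a-d}{3}\right)^3}{x^2+dx+\frac{(a-d)^2}{3}+b},\qquad x\in\mathbb{C}_p,\ x\neq x_1,x_2,$$ where $x_1,x_2\in\mathbb{C}_p$ are the zeros of the denominator. Put $x_0=\frac{a-d}{3}$, $\delta=\left|\frac{2a+d}{3}\right|_p$, $\alpha=|x_0-x_1|_p$, $\beta=|x_0-x_2|_p$, and assume $\alpha=\beta$. If $\alpha=\delta$, then the dynamical system generated by $f$ has the following properties. I. (I.i) $SI(x_0)=U_\alpha(x_0)$; (I.ii) $U_\alpha(x_0)\cap\mathcal{P}=\emptyset$. II. If $r>\alpha$ and $x\in S_r(x_0)$, then $f(x)\in S_\alpha(x_0)$. III. Let $f^k(x)\in S_\alpha(x_0)\setminus\mathcal{P}$ for some $k\in\{0,1,2,\dots\}$, and write $\hat\alpha=\hat\alpha(f^k(x))$. Then: if $\hat\alpha\geq\alpha$, then $f^{k+1}(x)\in S_{\hat\alpha}(x_0)$; if $\hat\alpha>\alpha$, then $f^{k+2}(x)\in S_\alpha(x_0)$; if $\hat\alpha<\alpha$, then $f^m(x)\in S_{\hat\alpha}(x_0)$ for all $m\geq k+1$.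
   Context: $p$ is a prime, $\mathbb{C}_p$ is the field of complex $p$-adic numbers with norm $|\cdot|_p$, and $\mathbb{N}=\{1,2,\dots\}$. For $c\in\mathbb{C}_p$ and $r\ge 0$: $U_r(c)=\{x\in\mathbb{C}_p:|x-c|_p<r\}$, $S_r(c)=\{x\in\mathbb{C}_p:|x-c|_p=r\}$. $f^n$ denotes the $n$-fold iterate of $f$ (with $f^0$ the identity), defined at $x$ as long as no earlier iterate is $x_1$ or $x_2$. The point $x_0$ is the unique fixed point of $f$. The set of points eventually mapped to a zero of the denominator is $$\mathcal{P}=\{x\in\mathbb{C}_p:\ \exists n\in\mathbb{N}\cup\{0\},\ f^n(x)\in\{x_1,x_2\}\}.$$ A ball $U_r(x_0)$ is a Siegel disk if each sphere $S_\rho(x_0)$, $\rho<r$, is invariant for $f$, i.e. $x\in S_\rho(x_0)$ implies that $f^n(x)$ is defined and lies in $S_\rho(x_0)$ for all $n\ge1$. $SI(x_0)$ (the maximum Siegel disk) is the union of all Siegel disks centered at $x_0$. For $y\in S_\alpha(x_0)$, $y\ne x_1,x_2$, $\hat\alpha(y)=|f(y)-x_0|_p$. *)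

theory Defs
  imports "HOL-Analysis.Abstract_Metric_Spaces" "HOL-Computational_Algebra.Computational_Algebra"
begin

section \<open>The field of complex p-adic numbers\<close>

definition padic_norm_rat :: "nat \<Rightarrow> rat \<Rightarrow> real" where
  "padic_norm_rat p q =
     (if q = 0 then 0
      else case quotient_of q of (m, n) \<Rightarrow>
        real p powi (int (multiplicity (int p) n) - int (multiplicity (int p) m)))"

locale nonarch_normed_field =
  fixes nrm :: "'a::field_char_0 \<Rightarrow> real"
  assumes nrm_nonneg: "nrm x \<ge> 0"
    and nrm_eq_0_iff: "nrm x = 0 \<longleftrightarrow> x = 0"
    and nrm_mult: "nrm (x * y) = nrm x * nrm y"
    and nrm_ultrametric: "nrm (x + y) \<le> max (nrm x) (nrm y)"
begin

lemma nrm_one: "nrm 1 = 1"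
  using nrm_mult[of 1 1] nrm_eq_0_iff[of 1] by simp

lemma nrm_uminus: "nrm (- x) = nrm x"
proof -
  have "(nrm (-1))\<^sup>2 = 1"
    using nrm_mult[of "-1" "-1"] nrm_one by (simp add: power2_eq_square)
  then have "nrm (-1) = 1"
    using nrm_nonneg[of "-1"] by (simp add: power2_eq_1_iff)
  then show ?thesis
    using nrm_mult[of "-1" x] by simp
qed

sublocale Metric_space UNIV "\<lambda>x y. nrm (x - y)"
proof
  fix x y z :: 'a
  show "nrm (x - y) = nrm (y - x)"
    using nrm_uminus[of "x - y"] by simp
  show "nrm (x - z) \<le> nrm (x - y) + nrm (y - z)"
    using nrm_ultrametric[of "x - y" "y - z"] nrm_nonneg[of "x - y"] nrm_nonneg[of "y - z"]
    by (simp add: max_def split: if_splits)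
qed (simp_all add: nrm_nonneg nrm_eq_0_iff)

text \<open>
  In a complete field extending the p-adically normed rationals, the closure of the
  rationals is the completion of the rationals, that is, the field of p-adic numbers.
\<close>

definition padic_numbers :: "'a set" where
  "padic_numbers = mtopology closure_of \<rat>"

definition padic_algebraic :: "'a set" where
  "padic_algebraic =
     {x. \<exists>P. P \<noteq> 0 \<and> (\<forall>i. poly.coeff P i \<in> padic_numbers) \<and> poly P x = 0}"

end

text \<open>
  The field of complex p-adic numbers is the completion of an algebraic closure of the
  p-adic numbers, with the norm extending the p-adic one. The locale expresses this inside
  the completed field: it is complete, and the elements algebraic over the p-adic numbers
  form an algebraically closed field that is dense in it. This determines the normed field
  up to isometric isomorphism, since the p-adic norm extends uniquely to algebraic extensions.
\<close>

locale complex_padic_field = nonarch_normed_field nrm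
  for p :: nat and nrm :: "'a::field_char_0 \<Rightarrow> real" +
  assumes prime_p: "prime p"
    and nrm_of_rat: "nrm (of_rat q) = padic_norm_rat p q"
    and complete: "mcomplete"
    and padic_algebraic_closed:
      "\<lbrakk>degree P > 0; \<And>i. poly.coeff P i \<in> padic_algebraic\<rbrakk>
        \<Longrightarrow> \<exists>x\<in>padic_algebraic. poly P x = 0"
    and padic_algebraic_dense: "mtopology closure_of padic_algebraic = UNIV"


section \<open>Balls and spheres\<close>

definition open_ball :: "('a::field_char_0 \<Rightarrow> real) \<Rightarrow> real \<Rightarrow> 'a \<Rightarrow> 'a set" where
  "open_ball nrm r c = {x. nrm (x - c) < r}"

definition nrm_sphere :: "('a::field_char_0 \<Rightarrow> real) \<Rightarrow> real \<Rightarrow> 'a \<Rightarrow> 'a set" where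
  "nrm_sphere nrm r c = {x. nrm (x - c) = r}"


section \<open>Dynamics of partial maps\<close>

text \<open>
  A map that is undefined at some points is an option-valued function; the value
  \<^term>\<open>None\<close> means undefined, and an iterate is undefined as soon as an earlier one is.
\<close>

primrec iterate :: "('a \<Rightarrow> 'a option) \<Rightarrow> nat \<Rightarrow> 'a \<Rightarrow> 'a option" where
  "iterate f 0 x = Some x"
| "iterate f (Suc n) x = Option.bind (iterate f n x) f"

definition iterate_in :: "('a \<Rightarrow> 'a option) \<Rightarrow> nat \<Rightarrow> 'a \<Rightarrow> 'a set \<Rightarrow> bool" where
  "iterate_in f n x A \<longleftrightarrow> (\<exists>y\<in>A. iterate f n x = Some y)"

definition ratfun_denom :: "'a::field_char_0 \<Rightarrow> 'a \<Rightarrow> 'a \<Rightarrow> 'a \<Rightarrow> 'a" where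
  "ratfun_denom a b d x = x^2 + d * x + ((a - d)^2 / 3 + b)"

definition ratfun :: "'a::field_char_0 \<Rightarrow> 'a \<Rightarrow> 'a \<Rightarrow> 'a \<Rightarrow> 'a option" where
  "ratfun a b d x =
     (if ratfun_denom a b d x = 0 then None
      else Some ((a * x^2 + b * x + ((a - d) / 3)^3) / ratfun_denom a b d x))"

definition exceptional_set :: "('a \<Rightarrow> 'a option) \<Rightarrow> 'a \<Rightarrow> 'a \<Rightarrow> 'a set" where
  "exceptional_set f x1 x2 = {x. \<exists>n. iterate_in f n x {x1, x2}}"

definition invariant_sphere ::
  "('a::field_char_0 \<Rightarrow> real) \<Rightarrow> ('a \<Rightarrow> 'a option) \<Rightarrow> real \<Rightarrow> 'a \<Rightarrow> bool" where
  "invariant_sphere nrm f \<rho> c \<longleftrightarrow>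
     (\<forall>x\<in>nrm_sphere nrm \<rho> c. \<forall>n\<ge>1. iterate_in f n x (nrm_sphere nrm \<rho> c))"

definition siegel_radius ::
  "('a::field_char_0 \<Rightarrow> real) \<Rightarrow> ('a \<Rightarrow> 'a option) \<Rightarrow> real \<Rightarrow> 'a \<Rightarrow> bool" where
  "siegel_radius nrm f r c \<longleftrightarrow> r > 0 \<and> (\<forall>\<rho>. 0 \<le> \<rho> \<and> \<rho> < r \<longrightarrow> invariant_sphere nrm f \<rho> c)"

definition max_siegel_disk ::
  "('a::field_char_0 \<Rightarrow> real) \<Rightarrow> ('a \<Rightarrow> 'a option) \<Rightarrow> 'a \<Rightarrow> 'a set" where
  "max_siegel_disk nrm f c = \<Union> {open_ball nrm r c | r. siegel_radius nrm f r c}"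

text \<open>Only meaningful where \<^term>\<open>f y\<close> is defined.\<close>

definition alpha_hat ::
  "('a::field_char_0 \<Rightarrow> real) \<Rightarrow> ('a \<Rightarrow> 'a option) \<Rightarrow> 'a \<Rightarrow> 'a \<Rightarrow> real" where
  "alpha_hat nrm f x0 y = nrm (the (f y) - x0)"

end

theory Submission
  imports Defs
begin

text \<open>
  In the coordinate \<open>t = x - x\<^sub>0\<close> the map becomes
  \<open>t \<mapsto> t (l t + e) / (t\<^sup>2 + l t + e)\<close> with \<open>l = (2 a + d) / 3\<close> and
  \<open>e = (x\<^sub>0 - x\<^sub>1) (x\<^sub>0 - x\<^sub>2)\<close>, so that \<open>|l| = \<alpha>\<close> and \<open>|e| = \<alpha>\<^sup>2\<close>. By the isosceles
  property of the norm, \<open>e\<close> dominates numerator and denominator for \<open>|t| < \<alpha>\<close>, which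
  gives \<open>|f(x) - x\<^sub>0| = |t|\<close>, while for \<open>|t| > \<alpha>\<close> the dominating terms \<open>l t\<close> and \<open>t\<^sup>2\<close>
  give \<open>|f(x) - x\<^sub>0| = \<alpha>\<close>. The sphere of radius \<open>\<alpha>\<close> contains the poles and hence is
  not invariant.
\<close>

lemma iterate_add:
  "iterate f (m + n) x = Option.bind (iterate f m x) (iterate f n)"
proof (induction n)
  case 0
  show ?case by (cases "iterate f m x") simp_all
next
  case (Suc n)
  then show ?case by (cases "iterate f m x") simp_all
qed

lemma iterate_in_if_invariant:
  assumes "\<And>x. x \<in> A \<Longrightarrow> \<exists>y\<in>A. f x = Some y" and "x \<in> A"
  shows "iterate_in f n x A"
proof (induction n)
  case 0
  show ?case using assms(2) by (simp add: iterate_in_def)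
next
  case (Suc n)
  then obtain y where "y \<in> A" "iterate f n x = Some y"
    by (auto simp: iterate_in_def)
  with assms(1)[of y] show ?case by (auto simp: iterate_in_def)
qed

lemma iterate_in_1: "iterate_in f 1 x A \<longleftrightarrow> (\<exists>y\<in>A. f x = Some y)"
  by (simp add: iterate_in_def)

lemma iterate_in_shift:
  assumes "iterate f k x = Some y"
  shows "iterate_in f (k + n) x A \<longleftrightarrow> iterate_in f n y A"
  using assms by (simp add: iterate_in_def iterate_add)

text \<open>An equality of root sets does not record multiplicities. Splitting off the root
  \<open>x1\<close> leaves the cofactor root \<open>c = - u - x1\<close>, and
  \<open>{x1, c} = {x1, x2}\<close> forces \<open>c = x2\<close> even for a double root.\<close>

lemma root_set_quadratic:
  fixes u v :: "'a::idom"
  assumes "{x. x\<^sup>2 + u * x + v = 0} = {x1, x2}"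
  shows "x\<^sup>2 + u * x + v = (x - x1) * (x - x2)"
proof -
  define c where "c = - u - x1"
  have "x1\<^sup>2 + u * x1 + v = 0" using assms by blast
  then have v: "v = - (x1\<^sup>2 + u * x1)" by (simp only: add_eq_0_iff)
  have factor: "z\<^sup>2 + u * z + v = (z - x1) * (z - c)" for z
    unfolding v c_def by (simp add: algebra_simps power2_eq_square)
  have "{x1, c} = {x1, x2}"
    using assms unfolding factor by auto
  then have "c = x2" by (auto simp: doubleton_eq_iff)
  with factor show ?thesis by simp
qed

text \<open>The fixed point equation \<open>f(x) = x\<close> reads \<open>(x - x\<^sub>0)\<^sup>3 = 0\<close>.\<close>

lemma ratfun_numer:
  fixes a b d x :: "'a::field_char_0"
  defines "x0 \<equiv> (a - d) / 3"
  shows "a * x^2 + b * x + ((a - d) / 3)^3 =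
    x * ratfun_denom a b d x - (x - x0)^3"
proof -
  have a: "a = 3 * x0 + d" by (simp add: x0_def field_simps)
  show ?thesis
    unfolding ratfun_denom_def a
    by (simp add: field_simps power2_eq_square power3_eq_cube)
qed

text \<open>Taylor expansion of the denominator at \<open>x0\<close>: the linear coefficient is
  \<open>2 * x0 + d\<close>, which equals \<open>(2 * a + d) / 3\<close>.\<close>

lemma ratfun_denom_centered:
  fixes a b d x :: "'a::field_char_0"
  defines "x0 \<equiv> (a - d) / 3"
  shows "ratfun_denom a b d x =
    (x - x0)^2 + (2 * a + d) / 3 * (x - x0) + ratfun_denom a b d x0"
proof -
  have a: "a = 3 * x0 + d" by (simp add: x0_def field_simps)
  show ?thesis
    unfolding ratfun_denom_def a
    by (simp add: field_simps power2_eq_square)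
qed

context nonarch_normed_field
begin

lemma nrm_divide: "nrm (x / y) = nrm x / nrm y"
proof (cases "y = 0")
  case True
  then show ?thesis using nrm_eq_0_iff[of 0] by simp
next
  case False
  then have "nrm x = nrm (x / y) * nrm y" by (simp flip: nrm_mult)
  with False show ?thesis by (simp add: nrm_eq_0_iff)
qed

lemma nrm_power: "nrm (x ^ n) = nrm x ^ n"
  by (induction n) (simp_all add: nrm_one nrm_mult)

text \<open>Writing \<open>x\<close> as \<open>(x + y) + (- y)\<close> shows that
  \<open>x + y\<close> cannot have smaller norm than \<open>x\<close>, because \<open>- y\<close> is
  too small to make up the difference.\<close>

lemma nrm_add_eq_left:
  assumes "nrm y < nrm x"
  shows "nrm (x + y) = nrm x"
  using nrm_ultrametric[of x y] nrm_ultrametric[of "x + y" "- y"] assms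
  by (auto simp: nrm_uminus)

lemma nrm_quadratic_near:
  assumes "nrm l = r" "nrm e = r\<^sup>2" "nrm t < r"
  shows "nrm (l * t + e) = r\<^sup>2" "nrm (t\<^sup>2 + l * t + e) = r\<^sup>2"
proof -
  have r: "r > 0" using nrm_nonneg[of t] assms(3) by linarith
  have "nrm (l * t) < nrm e"
    using assms r by (simp add: nrm_mult power2_eq_square)
  then show lin: "nrm (l * t + e) = r\<^sup>2"
    using nrm_add_eq_left[of "l * t" e] assms(2) by (simp add: add.commute)
  have "nrm (t\<^sup>2) < r\<^sup>2"
    using assms(3) nrm_nonneg[of t] by (simp add: nrm_power power_strict_mono)
  then show "nrm (t\<^sup>2 + l * t + e) = r\<^sup>2"
    using nrm_add_eq_left[of "t\<^sup>2" "l * t + e"] lin by (simp add: add_ac)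
qed

text \<open>The norms of \<open>e\<close>, \<open>l * t\<close> and \<open>t\<^sup>2\<close> are
  \<open>r\<^sup>2 < r * nrm t < (nrm t)\<^sup>2\<close>, so the leading term wins in each
  sum.\<close>

lemma nrm_quadratic_far:
  assumes "nrm l = r" "nrm e = r\<^sup>2" "nrm t > r" "r > 0"
  shows "nrm (l * t + e) = r * nrm t" "nrm (t\<^sup>2 + l * t + e) = (nrm t)\<^sup>2"
proof -
  have "nrm e < nrm (l * t)"
    using assms by (simp add: nrm_mult power2_eq_square)
  then show lin: "nrm (l * t + e) = r * nrm t"
    using nrm_add_eq_left[of e "l * t"] assms(1) by (simp add: nrm_mult)
  have "nrm (l * t + e) < nrm (t\<^sup>2)"
    using assms unfolding lin by (simp add: nrm_mult power2_eq_square)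
  then show "nrm (t\<^sup>2 + l * t + e) = (nrm t)\<^sup>2"
    using nrm_add_eq_left[of "l * t + e" "t\<^sup>2"] by (simp add: nrm_power add.assoc)
qed

text \<open>A Siegel radius above \<open>r\<close> would require the sphere of radius
  \<open>r\<close> itself to be invariant. Since \<open>r\<close> is a Siegel radius, the union is
  attained by its ball.\<close>

lemma max_siegel_disk_eqI:
  assumes "r > 0"
    and "\<And>\<rho>. 0 \<le> \<rho> \<Longrightarrow> \<rho> < r \<Longrightarrow> invariant_sphere nrm f \<rho> c"
    and "\<not> invariant_sphere nrm f r c"
  shows "max_siegel_disk nrm f c = open_ball nrm r c"
proof -
  have "s \<le> r" if "siegel_radius nrm f s c" for s
    using that assms(1,3) unfolding siegel_radius_def by (meson less_imp_le not_le)
  moreover have "siegel_radius nrm f r c"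
    using assms(1,2) by (simp add: siegel_radius_def)
  moreover have "open_ball nrm s c \<subseteq> open_ball nrm r c" if "s \<le> r" for s
    using that by (auto simp: open_ball_def)
  ultimately show ?thesis
    unfolding max_siegel_disk_def by blast
qed

end

theorem theorem4:
  fixes p :: nat
    and nrm :: "'a::field_char_0 \<Rightarrow> real"
    and a b d x0 x1 x2 :: 'a
    and f :: "'a \<Rightarrow> 'a option"
    and \<alpha> \<beta> \<delta> :: real
  assumes "complex_padic_field p nrm"
    and "a \<noteq> 0"
    and "b \<noteq> - 2 * a^2 \<or> d \<noteq> - 2 * a"
    and "{x. ratfun_denom a b d x = 0} = {x1, x2}"
    and "f = ratfun a b d"
    and "x0 = (a - d) / 3"
    and "\<delta> = nrm ((2 * a + d) / 3)"
    and "\<alpha> = nrm (x0 - x1)"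
    and "\<beta> = nrm (x0 - x2)"
    and "\<alpha> = \<beta>"
    and "\<alpha> = \<delta>"
  shows
    "(max_siegel_disk nrm f x0 = open_ball nrm \<alpha> x0 \<and>
      open_ball nrm \<alpha> x0 \<inter> exceptional_set f x1 x2 = {}) \<and>
     (\<forall>r x. r > \<alpha> \<and> x \<in> nrm_sphere nrm r x0 \<longrightarrow>
        iterate_in f 1 x (nrm_sphere nrm \<alpha> x0)) \<and>
     (\<forall>k x y. iterate f k x = Some y \<and>
        y \<in> nrm_sphere nrm \<alpha> x0 - exceptional_set f x1 x2 \<longrightarrow>
        (alpha_hat nrm f x0 y \<ge> \<alpha> \<longrightarrow>
           iterate_in f (k + 1) x (nrm_sphere nrm (alpha_hat nrm f x0 y) x0)) \<and>
        (alpha_hat nrm f x0 y > \<alpha> \<longrightarrow>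
           iterate_in f (k + 2) x (nrm_sphere nrm \<alpha> x0)) \<and>
        (alpha_hat nrm f x0 y < \<alpha> \<longrightarrow>
           (\<forall>m\<ge>k + 1. iterate_in f m x (nrm_sphere nrm (alpha_hat nrm f x0 y) x0))))"
proof -
  interpret complex_padic_field p nrm by fact
  define l where "l = (2 * a + d) / 3"
  define e where "e = ratfun_denom a b d x0"
  have denom_factor: "ratfun_denom a b d x = (x - x1) * (x - x2)" for x
    using root_set_quadratic[of d "(a - d)\<^sup>2 / 3 + b" x1 x2 x] assms(4)
    by (simp add: ratfun_denom_def)
  have l: "nrm l = \<alpha>" using assms(7,11) by (simp add: l_def)
  have e: "nrm e = \<alpha>\<^sup>2"
    using assms(8-10) by (simp add: e_def denom_factor nrm_mult power2_eq_square)
  \<comment> \<open>If \<alpha> were 0, then \<open>l = 0\<close> would give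
    \<open>d = - 2 * a\<close> and \<open>x0 = a\<close>, and \<open>e = 0\<close> would become
    \<open>b + 2 * a\<^sup>2 = 0\<close>: exactly the excluded pair of equations.\<close>
  have "\<alpha> \<noteq> 0"
  proof
    assume "\<alpha> = 0"
    then have "l = 0" "e = 0" using l e by (simp_all add: nrm_eq_0_iff)
    then have d: "d = - 2 * a" by (simp add: l_def eq_neg_iff_add_eq_0 add.commute)
    then have "x0 = a" using assms(6) by simp
    with \<open>e = 0\<close> d have "b + 2 * a\<^sup>2 = 0"
      by (simp add: e_def ratfun_denom_def power2_eq_square algebra_simps)
    then have "b = - 2 * a\<^sup>2" by (simp add: eq_neg_iff_add_eq_0)
    with d assms(3) show False by simp
  qed
  then have \<alpha>: "\<alpha> > 0" using assms(8) nrm_nonneg[of "x0 - x1"] by linarith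
  have denom: "ratfun_denom a b d x = (x - x0)\<^sup>2 + l * (x - x0) + e" for x
    unfolding l_def e_def assms(6) by (rule ratfun_denom_centered)
  \<comment> \<open>With \<open>t = x - x0\<close> and denominator \<open>D\<close>, the value is
    \<open>x - t^3 / D\<close>. Subtracting \<open>x0\<close> leaves
    \<open>t * (D - t\<^sup>2) / D\<close>, and \<open>D - t\<^sup>2 = l * t + e\<close>.\<close>
  have f_defined: "\<exists>y. f x = Some y \<and>
      nrm (y - x0) = nrm (x - x0) * nrm (l * (x - x0) + e) / nrm (ratfun_denom a b d x)"
    if "ratfun_denom a b d x \<noteq> 0" for x
  proof -
    define y where "y = (a * x^2 + b * x + ((a - d) / 3)^3) / ratfun_denom a b d x"
    have numer: "a * x^2 + b * x + ((a - d) / 3)^3 = x * ratfun_denom a b d x - (x - x0)^3"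
      unfolding assms(6) by (rule ratfun_numer)
    have "y = x - (x - x0)^3 / ratfun_denom a b d x"
      using that unfolding y_def numer by (simp add: diff_divide_distrib)
    then have "y - x0 = ((x - x0) * ratfun_denom a b d x - (x - x0)^3) / ratfun_denom a b d x"
      using that by (simp add: diff_divide_distrib)
    also have "(x - x0) * ratfun_denom a b d x - (x - x0)^3 = (x - x0) * (l * (x - x0) + e)"
      unfolding denom by (simp add: distrib_left power2_eq_square power3_eq_cube)
    finally have "nrm (y - x0) =
        nrm (x - x0) * nrm (l * (x - x0) + e) / nrm (ratfun_denom a b d x)"
      by (simp add: nrm_divide nrm_mult)
    then show ?thesis using that assms(5) by (simp add: ratfun_def y_def)
  qed
  have near: "\<exists>y. f x = Some y \<and> nrm (y - x0) = nrm (x - x0)" if "nrm (x - x0) < \<alpha>" for x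
  proof -
    note q = nrm_quadratic_near[OF l e that]
    have "ratfun_denom a b d x \<noteq> 0"
      using q(2) \<alpha> nrm_eq_0_iff[of "ratfun_denom a b d x"] unfolding denom by auto
    from f_defined[OF this] show ?thesis
      using \<alpha> unfolding denom q by auto
  qed
  \<comment> \<open>With \<open>s = nrm (x - x0)\<close>, the norm of the image's displacement from
    \<open>x0\<close> is \<open>s * (\<alpha> * s) / s\<^sup>2\<close>, which no longer depends on
    \<open>s\<close>.\<close>
  have far: "\<exists>y. f x = Some y \<and> nrm (y - x0) = \<alpha>" if "nrm (x - x0) > \<alpha>" for x
  proof -
    note q = nrm_quadratic_far[OF l e that \<alpha>]
    have "nrm (x - x0) > 0" using that \<alpha> by linarith
    moreover from this have "ratfun_denom a b d x \<noteq> 0"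
      using q(2) nrm_eq_0_iff[of "ratfun_denom a b d x"] unfolding denom by auto
    ultimately show ?thesis
      using f_defined[of x] unfolding denom q by (auto simp: power2_eq_square)
  qed
  have sphere_near: "iterate_in f n x (nrm_sphere nrm \<rho> x0)"
    if "\<rho> < \<alpha>" "x \<in> nrm_sphere nrm \<rho> x0" for n x \<rho>
  proof (rule iterate_in_if_invariant)
    show "x \<in> nrm_sphere nrm \<rho> x0" by fact
    show "\<exists>y\<in>nrm_sphere nrm \<rho> x0. f z = Some y" if "z \<in> nrm_sphere nrm \<rho> x0" for z
      using near[of z] that \<open>\<rho> < \<alpha>\<close> by (auto simp: nrm_sphere_def)
  qed
  have poles: "{x1, x2} \<subseteq> nrm_sphere nrm \<alpha> x0"
    using assms(8-10) nrm_uminus[of "x0 - x1"] nrm_uminus[of "x0 - x2"]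
    by (simp add: nrm_sphere_def)
  have undefined: "f x1 = None"
    using assms(5) by (simp add: ratfun_def denom_factor)
  have disk: "max_siegel_disk nrm f x0 = open_ball nrm \<alpha> x0"
  proof (rule max_siegel_disk_eqI[OF \<alpha>])
    show "invariant_sphere nrm f \<rho> x0" if "\<rho> < \<alpha>" for \<rho>
      using sphere_near[OF that] by (simp add: invariant_sphere_def)
    \<comment> \<open>Invariance also demands that iterates be defined, so a single pole on the
      sphere refutes it.\<close>
    have "\<not> iterate_in f 1 x1 (nrm_sphere nrm \<alpha> x0)"
      using undefined by (simp add: iterate_in_def)
    then show "\<not> invariant_sphere nrm f \<alpha> x0"
      using poles by (auto simp: invariant_sphere_def)
  qed
  have disjoint: "open_ball nrm \<alpha> x0 \<inter> exceptional_set f x1 x2 = {}"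
  proof -
    \<comment> \<open>The orbit stays at its initial distance from \<open>x0\<close>, below
      \<alpha>, whereas both poles lie at distance exactly \<alpha>.\<close>
    have False if "nrm (x - x0) < \<alpha>" "iterate_in f n x {x1, x2}" for x n
      using sphere_near[OF that(1), of x n] that poles
      by (auto simp: iterate_in_def nrm_sphere_def)
    then show ?thesis by (auto simp: open_ball_def exceptional_set_def)
  qed
  have outer: "iterate_in f 1 x (nrm_sphere nrm \<alpha> x0)" if "nrm (x - x0) > \<alpha>" for x
    using far[OF that] unfolding iterate_in_1 by (auto simp: nrm_sphere_def)
  have part3: "(alpha_hat nrm f x0 y \<ge> \<alpha> \<longrightarrow>
           iterate_in f (k + 1) x (nrm_sphere nrm (alpha_hat nrm f x0 y) x0)) \<and>
        (alpha_hat nrm f x0 y > \<alpha> \<longrightarrow>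
           iterate_in f (k + 2) x (nrm_sphere nrm \<alpha> x0)) \<and>
        (alpha_hat nrm f x0 y < \<alpha> \<longrightarrow>
           (\<forall>m\<ge>k + 1. iterate_in f m x (nrm_sphere nrm (alpha_hat nrm f x0 y) x0)))"
    if y: "iterate f k x = Some y" "y \<notin> exceptional_set f x1 x2" for k x y
  proof -
    \<comment> \<open>Since \<open>exceptional_set\<close> includes the zeroth iterate,
      \<open>y\<close> is not a pole. Hence \<open>f y\<close> is defined and \<open>the\<close> in
      \<open>alpha_hat\<close> returns a genuine value.\<close>
    have "iterate_in f 0 y {x1, x2} \<longleftrightarrow> y \<in> {x1, x2}" by (simp add: iterate_in_def)
    with y(2) have "y \<notin> {x1, x2}" unfolding exceptional_set_def by blast
    then obtain z where z: "f y = Some z"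
      using f_defined[of y] by (auto simp: denom_factor)
    then have hat: "alpha_hat nrm f x0 y = nrm (z - x0)" by (simp add: alpha_hat_def)
    from y(1) z have next_iterate: "iterate f (k + 1) x = Some z" by simp
    have "iterate_in f (k + 1) x (nrm_sphere nrm (nrm (z - x0)) x0)"
      using next_iterate by (simp add: iterate_in_def nrm_sphere_def)
    moreover have "iterate_in f (k + 2) x (nrm_sphere nrm \<alpha> x0)" if "nrm (z - x0) > \<alpha>"
      using iterate_in_shift[OF next_iterate, of 1] outer[OF that] by simp
    \<comment> \<open>The orbit is restarted at \<open>z\<close>, the iterate of index
      \<open>k + 1\<close>. For \<open>m = k + 1\<close> the remaining iterate is the zeroth, which
      \<open>sphere_near\<close> also covers.\<close>
    moreover have "iterate_in f m x (nrm_sphere nrm (nrm (z - x0)) x0)"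
      if "nrm (z - x0) < \<alpha>" "m \<ge> k + 1" for m
      using iterate_in_shift[OF next_iterate, of "m - (k + 1)"] sphere_near[OF that(1)] that(2)
      by (simp add: nrm_sphere_def)
    ultimately show ?thesis unfolding hat by blast
  qed
  show ?thesis
    using disk disjoint outer part3 by (auto simp: nrm_sphere_def)
qed

end
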